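(* Let $t$ be a non-zero complex number with $t \ne 1/e$. Then at least two of the three numbers $t+e$, $t\,e$ and $\ln t$ are transcendental.
   Context: $\ln z$ denotes the principal value of the complex logarithm, with argument in $(-\pi,\pi]$. A complex number is algebraic if it is a root of a non-trivial polynomial with rational coefficients; otherwise it is transcendental. *)

theory Defs
  imports "HOL-Analysis.Analysis" "HOL-Computational_Algebra.Computational_Algebra"
begin

(* The library's algebraic uses integer coefficients; algebraic_altdef gives the
   version with rational coefficients. *)
abbreviation transcendental :: "complex \<Rightarrow> bool"
  where "transcendental z \<equiv> \<not> algebraic z"

end

theory Submission
  imports Defs
begin

text \<open>
  All three pairings follow from one case of the Lindemann--Weierstrass theorem: for algebraic \<open>a\<close>
  and a natural number \<open>m\<close>, not both zero, \<open>exp a + m * exp 1\<close> is transcendental. The pair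
  \<open>t + e\<close>, \<open>Ln t\<close> is the case \<open>a = Ln t\<close>, \<open>m = 1\<close>; the pair \<open>t * e\<close>, \<open>Ln t\<close> is
  \<open>a = Ln t + 1\<close>, \<open>m = 0\<close>; and if \<open>t + e\<close> and \<open>t * e\<close> were algebraic, so would be their
  quadratic root \<open>e\<close>.

  If \<open>exp a + m * exp 1\<close> is a root of an integer polynomial \<open>P\<close>, consider the product of
  \<open>P(exp (a' z) + m * exp z)\<close> over the conjugates \<open>a'\<close> of \<open>a\<close>. It is an integer combination of
  exponentials \<open>exp (\<gamma> z)\<close> with algebraic \<open>\<gamma>\<close>, is not identically zero, has rational Taylor
  coefficients, and vanishes at \<open>z = 1\<close>. Multiplying it by its reflection under \<open>z \<mapsto> -z\<close> makes the
  weight of \<open>\<gamma> = 0\<close> a positive sum of squares. Hermite's method with the auxiliary polynomials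
  \<open>x ^ (p - 1) * h ^ p\<close>, where \<open>h\<close> is an integer polynomial vanishing at all nonzero exponents,
  then produces for large primes \<open>p\<close> a nonzero multiple of \<open>(p - 1)!\<close> that is bounded by
  \<open>C * K ^ p\<close>.
\<close>

section \<open>Hermite's method\<close>

lemma fact_eq_pochhammer_Suc:
  assumes "i \<le> n"
  shows "fact n = fact i * pochhammer (of_nat (Suc i)) (n - i)"
  using pochhammer_product[OF assms, of 1] by (simp add: pochhammer_fact)

text \<open>The product (n+1)...(n+k) is k! times a binomial coefficient. Such products appear as
  factors under k-fold differentiation, so derivatives of order at least \<open>p\<close> of an
  integer polynomial have coefficients divisible by p!.\<close>

lemma fact_dvd_pochhammer_Suc:
  assumes "p \<le> k"
  shows "(fact p :: nat) dvd pochhammer (Suc n) k"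
proof -
  have "(fact k :: nat) * fact n dvd fact (k + n)"
    by (rule fact_fact_dvd_fact)
  also have "(fact (k + n) :: nat) = pochhammer (Suc n) k * fact n"
    using fact_eq_pochhammer_Suc[of n "k + n", where 'a = nat] by (simp add: mult.commute)
  finally have "(fact k :: nat) dvd pochhammer (Suc n) k"
    by simp
  with fact_dvd[OF assms, where 'a = nat] show ?thesis
    using dvd_trans by blast
qed

lemma poly_eq_sum_le:
  fixes p :: "'a :: comm_semiring_1 poly"
  assumes "degree p \<le> N"
  shows "poly p x = (\<Sum>i\<le>N. coeff p i * x ^ i)"
  unfolding poly_altdef using assms
  by (intro sum.mono_neutral_left) (auto simp: coeff_eq_0)

lemma poly_higher_pderiv:
  fixes p :: "'a :: {comm_semiring_1,semiring_no_zero_divisors,semiring_char_0} poly"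
  assumes "degree p - k \<le> N"
  shows "poly ((pderiv ^^ k) p) x =
    (\<Sum>i\<le>N. pochhammer (of_nat (Suc i)) k * coeff p (i + k) * x ^ i)"
  using poly_eq_sum_le[of "(pderiv ^^ k) p" N x] assms
  by (simp add: degree_higher_pderiv coeff_higher_pderiv)

text \<open>Regrouping by the coefficients of \<open>p\<close>: differentiating X^n in all orders
  and evaluating at \<open>b\<close> yields n! times the exponential series at \<open>b\<close>
  truncated after degree n. This is the link between Hermite's sum of derivatives and
  \<open>exp b\<close>.\<close>

lemma sum_higher_pderiv:
  fixes p :: "complex poly"
  shows "(\<Sum>k\<le>degree p. poly ((pderiv ^^ k) p) b) =
    (\<Sum>n\<le>degree p. coeff p n * (\<Sum>k\<le>n. fact n / fact k * b ^ k))"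
proof -
  define g where "g i j = pochhammer (of_nat (Suc i)) j * coeff p (i + j) * b ^ i" for i j
  have set_eq: "Sigma {..degree p} (\<lambda>k. {..degree p - k}) = {(i, j). i + j \<le> degree p}"
    by auto
  have "(\<Sum>k\<le>degree p. poly ((pderiv ^^ k) p) b) = (\<Sum>k\<le>degree p. \<Sum>i\<le>degree p - k. g i k)"
    unfolding g_def by (intro sum.cong refl poly_higher_pderiv) auto
  also have "\<dots> = (\<Sum>(k, i)\<in>{(i, j). i + j \<le> degree p}. g i k)"
    by (subst sum.Sigma) (auto simp: set_eq)
  also have "\<dots> = (\<Sum>(i, k)\<in>{(i, j). i + j \<le> degree p}. g i k)"
    by (rule sum.reindex_bij_witness[where i = prod.swap and j = prod.swap]) auto
  also have "\<dots> = (\<Sum>n\<le>degree p. \<Sum>i\<le>n. g i (n - i))"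
    by (rule sum.triangle_reindex_eq)
  also have "\<dots> = (\<Sum>n\<le>degree p. coeff p n * (\<Sum>k\<le>n. fact n / fact k * b ^ k))"
    unfolding g_def sum_distrib_left
    by (intro sum.cong refl) (simp add: fact_eq_pochhammer_Suc[where 'a = complex])
  finally show ?thesis .
qed

text \<open>The remainder is the series of n! b^(n+m+1) / (n+m+1)!, and n! (m+1)! \<le> (n+m+1)!
  lets the factor |b|^n be split off, leaving a tail of the series of exp |b|.\<close>

lemma norm_fact_times_exp_remainder:
  fixes b :: complex
  shows "norm (fact n * exp b - (\<Sum>k\<le>n. fact n / fact k * b ^ k)) \<le> norm b ^ n * exp (norm b)"
proof -
  define f where "f m = fact n * (b ^ (m + Suc n) /\<^sub>R fact (m + Suc n))" for m
  define g where "g m = norm b ^ n * (norm b ^ m /\<^sub>R fact m)" for m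
  have sum_f: "summable (\<lambda>m. b ^ (m + Suc n) /\<^sub>R fact (m + Suc n))"
    using summable_ignore_initial_segment[OF summable_exp_generic[of b], of "Suc n"] by simp
  have g_sums: "g sums (norm b ^ n * exp (norm b))"
    unfolding g_def exp_def
    by (intro sums_mult summable_sums summable_exp_generic)
  have le: "norm (f m) \<le> g (Suc m)" for m
  proof -
    have "(fact n :: nat) * fact (Suc m) \<le> fact (n + Suc m)"
      by (intro dvd_imp_le fact_fact_dvd_fact) simp
    then have "real (fact n * fact (Suc m)) \<le> real (fact (n + Suc m))"
      by (rule of_nat_mono)
    then have *: "fact n * fact (Suc m) \<le> (fact (m + Suc n) :: real)"
      by (simp only: of_nat_mult of_nat_fact add.commute add_Suc add_Suc_right)
    have "norm (f m) = norm b ^ (n + Suc m) * (fact n / fact (m + Suc n))"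
      by (simp add: f_def norm_mult norm_power divide_inverse mult_ac add_ac del: fact_Suc)
    also have "\<dots> \<le> norm b ^ (n + Suc m) * (1 / fact (Suc m))"
      using * by (intro mult_left_mono) (simp_all add: field_simps del: fact_Suc)
    finally show ?thesis
      by (simp add: g_def power_add divide_inverse mult_ac del: fact_Suc)
  qed
  have g_Suc: "summable (\<lambda>m. g (Suc m))"
    using g_sums by (simp add: sums_iff summable_Suc_iff)
  have "exp b = (\<Sum>k<Suc n. b ^ k /\<^sub>R fact k) + (\<Sum>m. b ^ (m + Suc n) /\<^sub>R fact (m + Suc n))"
    by (rule exp_first_terms)
  then have "fact n * exp b - (\<Sum>k\<le>n. fact n / fact k * b ^ k) = suminf f"
    unfolding f_def suminf_mult[OF sum_f]
    by (simp add: algebra_simps sum_distrib_left lessThan_Suc_atMost divide_inverse scaleR_conv_of_real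
         del: fact_Suc)
  also have "norm (suminf f) \<le> (\<Sum>m. g (Suc m))"
    by (intro norm_suminf_le le g_Suc)
  also have "\<dots> \<le> suminf g"
    using suminf_split_head[of g] g_sums by (auto simp: sums_iff g_def)
  finally show ?thesis
    using g_sums by (simp add: sums_iff)
qed

section \<open>Majorants of complex polynomials\<close>

definition norm_poly :: "complex poly \<Rightarrow> real poly"
  where "norm_poly p = map_poly norm p"

lemma coeff_norm_poly [simp]: "coeff (norm_poly p) i = norm (coeff p i)"
  by (simp add: norm_poly_def coeff_map_poly)

lemma degree_norm_poly [simp]: "degree (norm_poly p) = degree p"
  unfolding norm_poly_def by (rule degree_map_poly) auto

lemma poly_norm_poly_nonneg: "x \<ge> 0 \<Longrightarrow> poly (norm_poly p) x \<ge> 0"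
  by (auto simp: poly_altdef intro!: sum_nonneg)

lemma poly_norm_poly_mono: "0 \<le> x \<Longrightarrow> x \<le> y \<Longrightarrow> poly (norm_poly p) x \<le> poly (norm_poly p) y"
  by (auto simp: poly_altdef intro!: sum_mono mult_left_mono power_mono)

text \<open>This is the triangle inequality for the convolution of coefficients. Submultiplicativity
  allows the auxiliary polynomial x^(p-1) h^p to be bounded factor by factor.\<close>

lemma poly_norm_poly_mult_le:
  assumes "x \<ge> 0"
  shows "poly (norm_poly (p * q)) x \<le> poly (norm_poly p) x * poly (norm_poly q) x"
proof -
  define N where "N = degree p + degree q"
  have "poly (norm_poly (p * q)) x = (\<Sum>i\<le>N. norm (coeff (p * q) i) * x ^ i)"
    using poly_eq_sum_le[of "norm_poly (p * q)" N x] by (simp add: N_def degree_mult_le)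
  also have "\<dots> \<le> (\<Sum>i\<le>N. coeff (norm_poly p * norm_poly q) i * x ^ i)"
    using assms by (intro sum_mono mult_right_mono)
      (auto simp: coeff_mult norm_mult intro!: sum_norm_le)
  also have "\<dots> = poly (norm_poly p * norm_poly q) x"
    using degree_mult_le[of "norm_poly p" "norm_poly q"]
    by (intro poly_eq_sum_le[symmetric]) (simp add: N_def)
  finally show ?thesis by simp
qed

lemma poly_norm_poly_power_le:
  assumes "x \<ge> 0"
  shows "poly (norm_poly (p ^ n)) x \<le> poly (norm_poly p) x ^ n"
proof (induction n)
  case 0
  then show ?case by (simp add: norm_poly_def)
next
  case (Suc n)
  have "poly (norm_poly (p ^ Suc n)) x \<le> poly (norm_poly p) x * poly (norm_poly (p ^ n)) x"
    using poly_norm_poly_mult_le[OF assms] by simp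
  also have "\<dots> \<le> poly (norm_poly p) x * poly (norm_poly p) x ^ n"
    using Suc by (intro mult_left_mono poly_norm_poly_nonneg assms)
  finally show ?case by simp
qed

text \<open>Hermite's estimate: with F the sum of all derivatives of \<open>p\<close>, the first sum
  is F(0), and F(0) exp b - F(b) is a combination of exponential remainders. No factorial survives
  in the bound.\<close>

lemma norm_exp_sum_higher_pderiv:
  fixes p :: "complex poly"
  shows "norm ((\<Sum>n\<le>degree p. coeff p n * fact n) * exp b - (\<Sum>k\<le>degree p. poly ((pderiv ^^ k) p) b))
    \<le> exp (norm b) * poly (norm_poly p) (norm b)"
proof -
  have "(\<Sum>n\<le>degree p. coeff p n * fact n) * exp b - (\<Sum>k\<le>degree p. poly ((pderiv ^^ k) p) b) =
    (\<Sum>n\<le>degree p. coeff p n * (fact n * exp b - (\<Sum>k\<le>n. fact n / fact k * b ^ k)))"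
    by (simp add: sum_higher_pderiv sum_subtractf sum_distrib_right right_diff_distrib mult.assoc)
  also have "norm \<dots> \<le> (\<Sum>n\<le>degree p. norm (coeff p n) * (norm b ^ n * exp (norm b)))"
    by (intro sum_norm_le) (simp only: norm_mult mult_left_mono norm_fact_times_exp_remainder norm_ge_zero)
  also have "\<dots> = exp (norm b) * poly (norm_poly p) (norm b)"
    by (simp add: poly_altdef sum_distrib_left mult_ac)
  finally show ?thesis .
qed

section \<open>Multiple roots, integrality and the choice of the prime\<close>

lemma linear_power_dvd_higher_pderiv:
  fixes p :: "'a :: idom poly"
  assumes "[:- a, 1:] ^ (m + k) dvd p"
  shows "[:- a, 1:] ^ m dvd (pderiv ^^ k) p"
  using assms
proof (induction k arbitrary: p)
  case (Suc k)
  from Suc.prems obtain q where "p = [:- a, 1:] ^ Suc (m + k) * q"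
    unfolding add_Suc_right by (rule dvdE)
  then have "pderiv p = [:- a, 1:] ^ (m + k) * ([:- a, 1:] * pderiv q + smult (of_nat (Suc (m + k))) q)"
    by (simp only: lemma_order_pderiv1)
      (simp add: distrib_left mult_ac del: of_nat_Suc mult_pCons_left mult_pCons_right)
  then have "[:- a, 1:] ^ m dvd (pderiv ^^ k) (pderiv p)"
    by (intro Suc.IH) (metis dvd_triv_left)
  then show ?case by (simp add: funpow_Suc_right del: funpow.simps)
qed auto

lemma poly_higher_pderiv_eq_0:
  fixes p :: "'a :: idom poly"
  assumes "[:- a, 1:] ^ n dvd p" "k < n"
  shows "poly ((pderiv ^^ k) p) a = 0"
proof -
  have "[:- a, 1:] ^ (1 + k) dvd p"
    using assms(2) by (intro dvd_trans[OF le_imp_power_dvd assms(1)]) simp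
  then have "[:- a, 1:] ^ 1 dvd (pderiv ^^ k) p"
    by (rule linear_power_dvd_higher_pderiv)
  then show ?thesis by (simp add: poly_eq_0_iff_dvd)
qed

lemma coeff_mult_Ints:
  assumes "\<And>i. coeff p i \<in> \<int>" "\<And>i. coeff q i \<in> \<int>"
  shows "coeff (p * q) i \<in> \<int>"
  by (auto simp: coeff_mult intro!: Ints_sum Ints_mult assms)

lemma coeff_power_Ints:
  assumes "\<And>i. coeff p i \<in> \<int>"
  shows "coeff (p ^ n) i \<in> \<int>"
proof (induction n arbitrary: i)
  case 0
  then show ?case by (auto simp: coeff_pCons split: nat.splits)
next
  case (Suc n)
  then show ?case using assms by (auto intro!: coeff_mult_Ints)
qed

text \<open>The terms K^m / m! of the exponential series tend to 0; the claim is this at m = p - 1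
  for a large prime.\<close>

lemma exists_prime_fact_gt:
  fixes C K :: real
  shows "\<exists>p. prime p \<and> p > n \<and> C * K ^ p < fact (p - 1)"
proof -
  have "(\<lambda>m. C * K * (inverse (fact m) * K ^ m)) \<longlonglongrightarrow> C * K * 0"
    by (intro tendsto_mult tendsto_const summable_LIMSEQ_zero summable_exp)
  then have "eventually (\<lambda>m. C * K * (inverse (fact m) * K ^ m) < 1) sequentially"
    by (intro order_tendstoD(2)[of _ "C * K * 0"]) auto
  then obtain N where N: "C * K * (inverse (fact m) * K ^ m) < 1" if "m \<ge> N" for m
    by (auto simp: eventually_sequentially)
  obtain p where p: "prime p" "p > Suc (max n N)"
    using bigger_prime by blast
  then obtain m where m: "p = Suc m" "m \<ge> N"
    by (cases p) auto
  have "C * K ^ p < fact (p - 1)"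
    using N[OF m(2)] by (simp add: m(1) field_simps)
  with p show ?thesis by (intro exI[of _ p]) auto
qed

text \<open>Let S be the weighted sum over \<open>b i\<close> of all derivatives of q = x^(p-1) h^p.
  Orders below p-1 contribute nothing, order p-1 contributes only at zero exponents, and orders from
  p on give multiples of p! once denominators are cleared by a power of \<open>l\<close>. Hence this
  multiple of S is a nonzero multiple of (p-1)!. If the exponential sum vanished, Hermite's estimate
  would make S too small.\<close>

lemma exp_sum_ne_0:
  fixes w :: "'i \<Rightarrow> int" and b :: "'i \<Rightarrow> complex" and h :: "complex poly" and l :: int
  assumes fin: "finite I"
    and weight: "(\<Sum>i | i \<in> I \<and> b i = 0. w i) \<noteq> 0"
    and h: "\<And>n. coeff h n \<in> \<int>" "coeff h 0 \<noteq> 0"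
    and roots: "\<And>i. i \<in> I \<Longrightarrow> b i \<noteq> 0 \<Longrightarrow> poly h (b i) = 0"
    and l: "l \<noteq> 0" "\<And>n. of_int l ^ n * (\<Sum>i\<in>I. of_int (w i) * b i ^ n) \<in> \<int>"
  shows "(\<Sum>i\<in>I. of_int (w i) * exp (b i)) \<noteq> 0"
proof
  assume zero: "(\<Sum>i\<in>I. of_int (w i) * exp (b i)) = 0"
  define w0 where "w0 = (\<Sum>i | i \<in> I \<and> b i = 0. w i)"
  obtain h0 where h0: "coeff h 0 = of_int h0" "h0 \<noteq> 0"
    using h by (metis Ints_cases of_int_0)
  define d where "d = degree h"
  \<comment> \<open>The summand 1 ensures B \<ge> 1, so that powers of \<open>B\<close> increase
    with the exponent.\<close>
  define B where "B = 1 + (\<Sum>i\<in>I. norm (b i))"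
  have B: "norm (b i) \<le> B" if "i \<in> I" for i
    using member_le_sum[of i I "\<lambda>i. norm (b i)"] fin that by (simp add: B_def)
  have B1: "B \<ge> 1" by (simp add: B_def sum_nonneg)
  define L where "L = real_of_int \<bar>l\<bar>"
  have L1: "L \<ge> 1" using l(1) by (simp add: L_def)
  define W where "W = (\<Sum>i\<in>I. of_int \<bar>w i\<bar> * exp B)"
  have W0: "W \<ge> 0" unfolding W_def by (intro sum_nonneg) auto
  \<comment> \<open>The three factors absorb \<open>L ^ M\<close> (as M \<le> (d + 1) p), the
    monomial x^(p-1), and \<open>h ^ p\<close>.\<close>
  define K where "K = L ^ (Suc d) * B * poly (norm_poly h) B"
  \<comment> \<open>The size of \<open>p\<close> prevents it from dividing the nonzero integers
    \<open>w0\<close>, \<open>l\<close> and \<open>h0\<close>.\<close>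
  obtain p where p: "prime p" "p > nat (\<bar>w0\<bar> + \<bar>l\<bar> + \<bar>h0\<bar>)" "W * K ^ p < fact (p - 1)"
    using exists_prime_fact_gt by blast
  have p0: "p > 0" using p(1) prime_gt_0_nat by blast
  define q where "q = monom 1 (p - 1) * h ^ p"
  define M where "M = degree q"
  have hne: "h \<noteq> 0" using h(2) by auto
  have M: "M = p - 1 + d * p"
    using hne by (simp add: M_def q_def degree_mult_eq degree_power_eq degree_monom_eq d_def mult.commute)
  have q_Ints: "coeff q n \<in> \<int>" for n
    unfolding q_def by (intro coeff_mult_Ints coeff_power_Ints h(1)) auto
  define T where "T k = (\<Sum>i\<in>I. of_int (w i) * poly ((pderiv ^^ k) q) (b i))" for k
  have pderiv_nonzero: "poly ((pderiv ^^ k) q) (b i) = 0" if "i \<in> I" "b i \<noteq> 0" "k < p" for i k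
  proof (rule poly_higher_pderiv_eq_0)
    have "[:- b i, 1:] dvd h"
      using roots that by (simp add: poly_eq_0_iff_dvd)
    then show "[:- b i, 1:] ^ p dvd q"
      unfolding q_def by (intro dvd_mult dvd_power_same)
  qed fact
  have pderiv_zero: "poly ((pderiv ^^ k) q) 0 = 0" if "k < p - 1" for k
  proof (rule poly_higher_pderiv_eq_0)
    show "[:- 0, 1:] ^ (p - 1) dvd q"
      unfolding q_def by (simp add: monom_altdef)
  qed fact
  have T_low: "T k = 0" if "k < p - 1" for k
    unfolding T_def using that pderiv_zero[of k] pderiv_nonzero[of _ k]
    by (intro sum.neutral ballI) (metis less_trans diff_less mult_zero_right p0 zero_less_one)
  \<comment> \<open>At a nonzero exponent \<open>q\<close> vanishes to order \<open>p\<close>, so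
    only the zero exponents count; the coefficient of x^(p-1) in \<open>q\<close> is h0^p.\<close>
  have T_mid: "T (p - 1) = of_int (fact (p - 1) * (w0 * h0 ^ p))"
  proof -
    have "coeff q (p - 1) = of_int (h0 ^ p)"
      by (simp add: q_def coeff_monom_mult coeff_0_power h0)
    then have *: "poly ((pderiv ^^ (p - 1)) q) 0 = of_int (fact (p - 1) * h0 ^ p)"
      by (simp add: poly_0_coeff_0 coeff_higher_pderiv flip: pochhammer_fact)
    have "T (p - 1) = (\<Sum>i | i \<in> I \<and> b i = 0. of_int (w i) * poly ((pderiv ^^ (p - 1)) q) (b i))"
      unfolding T_def using pderiv_nonzero[of _ "p - 1"] p0
      by (intro sum.mono_neutral_right fin) auto
    also have "\<dots> = (\<Sum>i | i \<in> I \<and> b i = 0. of_int (w i) * of_int (fact (p - 1) * h0 ^ p))"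
      using * by (intro sum.cong) auto
    also have "\<dots> = of_int (w0 * (fact (p - 1) * h0 ^ p))"
      by (simp add: w0_def sum_distrib_right)
    finally show ?thesis by (simp add: mult_ac)
  qed
  have T_high: "\<exists>z. of_int l ^ M * T k = of_int (fact p * z)" if "k \<ge> p" for k
  proof -
    \<comment> \<open>Exchanging the sums expresses \<open>T k\<close> through weighted power sums
      of the \<open>b i\<close>, which are the quantities that \<open>l\<close> is assumed to make
      integral.\<close>
    have "of_int l ^ M * T k = (\<Sum>n\<le>M. pochhammer (of_nat (Suc n)) k * coeff q (n + k) *
        (of_int l ^ M * (\<Sum>i\<in>I. of_int (w i) * b i ^ n)))"
    proof -
      have "T k = (\<Sum>i\<in>I. \<Sum>n\<le>M. of_int (w i) * (pochhammer (of_nat (Suc n)) k * coeff q (n + k) * b i ^ n))"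
        unfolding T_def by (subst poly_higher_pderiv[where N = M]) (auto simp: M_def sum_distrib_left)
      also have "\<dots> = (\<Sum>n\<le>M. \<Sum>i\<in>I. of_int (w i) * (pochhammer (of_nat (Suc n)) k * coeff q (n + k) * b i ^ n))"
        by (rule sum.swap)
      finally show ?thesis by (simp add: sum_distrib_left mult_ac)
    qed
    also have "\<dots> = fact p * (\<Sum>n\<le>M. of_nat (pochhammer (Suc n) k div fact p) * coeff q (n + k) *
        (of_int l ^ (M - n) * (of_int l ^ n * (\<Sum>i\<in>I. of_int (w i) * b i ^ n))))"
      unfolding sum_distrib_left[of "fact p"]
    proof (intro sum.cong refl)
      fix n assume "n \<in> {..M}"
      have "(pochhammer (of_nat (Suc n)) k :: complex) = of_nat (fact p * (pochhammer (Suc n) k div fact p))"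
        using fact_dvd_pochhammer_Suc[OF that, of n] by (simp add: pochhammer_of_nat del: of_nat_Suc)
      moreover have "(of_int l ^ M :: complex) = of_int l ^ (M - n) * of_int l ^ n"
        using \<open>n \<in> {..M}\<close> by (simp flip: power_add)
      ultimately show "pochhammer (of_nat (Suc n)) k * coeff q (n + k) *
          (of_int l ^ M * (\<Sum>i\<in>I. of_int (w i) * b i ^ n)) =
        fact p * (of_nat (pochhammer (Suc n) k div fact p) * coeff q (n + k) *
        (of_int l ^ (M - n) * (of_int l ^ n * (\<Sum>i\<in>I. of_int (w i) * b i ^ n))))"
        by (simp add: mult_ac)
    qed
    finally have eq: "of_int l ^ M * T k = fact p * (\<Sum>n\<le>M. of_nat (pochhammer (Suc n) k div fact p) * coeff q (n + k) *
        (of_int l ^ (M - n) * (of_int l ^ n * (\<Sum>i\<in>I. of_int (w i) * b i ^ n))))" .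
    have "(\<Sum>n\<le>M. of_nat (pochhammer (Suc n) k div fact p) * coeff q (n + k) *
        (of_int l ^ (M - n) * (of_int l ^ n * (\<Sum>i\<in>I. of_int (w i) * b i ^ n)))) \<in> \<int>"
      by (intro Ints_sum Ints_mult q_Ints l(2) Ints_power) auto
    then show ?thesis using eq by (auto elim!: Ints_cases)
  qed
  then obtain z where z: "of_int l ^ M * T k = of_int (fact p * z k)" if "k \<ge> p" for k
    by metis
  \<comment> \<open>Since p! = (p-1)! p, everything except the term of order p-1 is divisible by
    \<open>p\<close> after removing (p-1)!; so \<open>Z\<close> is nonzero modulo
    \<open>p\<close>.\<close>
  define Z where "Z = w0 * h0 ^ p * l ^ M + int p * (\<Sum>k\<in>{p..M}. z k)"
  have "of_int l ^ M * (\<Sum>k\<le>M. T k) = of_int (fact (p - 1) * Z)"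
  proof -
    have "p - 1 \<le> M" by (simp add: M)
    then have "{..M} = {..<p - 1} \<union> {p - 1} \<union> {p..M}" using p0 by auto
    then have "(\<Sum>k\<le>M. T k) = (\<Sum>k<p - 1. T k) + T (p - 1) + (\<Sum>k=p..M. T k)"
      using p0 by (simp only:) (subst sum.union_disjoint; force)+
    then have "of_int l ^ M * (\<Sum>k\<le>M. T k) = of_int (fact (p - 1) * (w0 * h0 ^ p)) * of_int l ^ M +
        (\<Sum>k=p..M. of_int l ^ M * T k)"
      by (simp add: T_low T_mid algebra_simps sum_distrib_left del: One_nat_def)
    also have "(\<Sum>k=p..M. of_int l ^ M * T k) = of_int (fact p * (\<Sum>k=p..M. z k))"
      by (simp add: z sum_distrib_left)
    also have "(fact p :: int) = fact (p - 1) * int p"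
      using p0 by (simp add: fact_reduce[of p] mult.commute)
    finally show ?thesis by (simp add: Z_def algebra_simps)
  qed
  moreover have "Z \<noteq> 0"
  proof
    assume "Z = 0"
    then have "int p dvd w0 * h0 ^ p * l ^ M"
      unfolding Z_def by (metis add.commute dvd_0_right dvd_add_right_iff dvd_triv_left)
    moreover have "prime (int p)" using p(1) by simp
    ultimately have "int p dvd w0 \<or> int p dvd h0 \<or> int p dvd l"
      by (metis prime_dvd_multD prime_dvd_power)
    moreover have "\<not> int p dvd x" if "x \<noteq> 0" "\<bar>x\<bar> \<le> \<bar>w0\<bar> + \<bar>l\<bar> + \<bar>h0\<bar>" for x
      using that p(2) dvd_imp_le_int[of x "int p"] by auto
    ultimately show False
      using weight h0(2) l(1) by (auto simp: w0_def)
  qed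
  ultimately have "fact (p - 1) \<le> norm (of_int l ^ M * (\<Sum>k\<le>M. T k))"
    by (simp add: norm_mult)
  also have "\<dots> = L ^ M * norm (\<Sum>k\<le>M. T k)"
    by (simp add: norm_mult norm_power L_def)
  also have "norm (\<Sum>k\<le>M. T k) \<le> W * (B ^ p * poly (norm_poly h) B ^ p)"
  proof -
    define c where "c = (\<Sum>n\<le>M. coeff q n * fact n)"
    have "(\<Sum>k\<le>M. T k) = (\<Sum>i\<in>I. of_int (w i) * (\<Sum>k\<le>M. poly ((pderiv ^^ k) q) (b i)))"
      unfolding T_def by (subst sum.swap) (simp add: sum_distrib_left)
    \<comment> \<open>The assumed vanishing of the exponential sum allows
      \<open>c * exp (b i)\<close> to be inserted in every term.\<close>
    also have "\<dots> = - (\<Sum>i\<in>I. of_int (w i) * (c * exp (b i) - (\<Sum>k\<le>M. poly ((pderiv ^^ k) q) (b i))))"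
    proof -
      have "(\<Sum>i\<in>I. of_int (w i) * (c * exp (b i))) = c * (\<Sum>i\<in>I. of_int (w i) * exp (b i))"
        by (simp add: sum_distrib_left mult_ac)
      then show ?thesis using zero by (simp add: right_diff_distrib sum_subtractf)
    qed
    also have "norm \<dots> \<le> (\<Sum>i\<in>I. of_int \<bar>w i\<bar> * (exp B * (B ^ p * poly (norm_poly h) B ^ p)))"
      unfolding norm_minus_cancel
    proof (rule sum_norm_le)
      fix i assume i: "i \<in> I"
      have "norm (c * exp (b i) - (\<Sum>k\<le>M. poly ((pderiv ^^ k) q) (b i)))
          \<le> exp (norm (b i)) * poly (norm_poly q) (norm (b i))"
        unfolding c_def M_def by (rule norm_exp_sum_higher_pderiv)
      also have "\<dots> \<le> exp B * poly (norm_poly q) B"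
        using B[OF i] by (intro mult_mono poly_norm_poly_mono poly_norm_poly_nonneg) auto
      also have "poly (norm_poly q) B \<le> poly (norm_poly (monom 1 (p - 1))) B * poly (norm_poly (h ^ p)) B"
        unfolding q_def using B1 by (intro poly_norm_poly_mult_le) auto
      also have "poly (norm_poly (monom 1 (p - 1))) B = B ^ (p - 1)"
        by (simp add: norm_poly_def map_poly_monom poly_monom)
      also have "B ^ (p - 1) * poly (norm_poly (h ^ p)) B \<le> B ^ p * poly (norm_poly h) B ^ p"
        using B1 by (intro mult_mono power_increasing poly_norm_poly_power_le poly_norm_poly_nonneg) auto
      finally show "norm (of_int (w i) * (c * exp (b i) - (\<Sum>k\<le>M. poly ((pderiv ^^ k) q) (b i))))
          \<le> of_int \<bar>w i\<bar> * (exp B * (B ^ p * poly (norm_poly h) B ^ p))"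
        by (auto simp: norm_mult intro!: mult_left_mono)
    qed
    also have "\<dots> = W * (B ^ p * poly (norm_poly h) B ^ p)"
      by (simp add: W_def sum_distrib_right mult.assoc)
    finally show ?thesis .
  qed
  also have "L ^ M * (W * (B ^ p * poly (norm_poly h) B ^ p)) \<le>
      L ^ (Suc d * p) * (W * (B ^ p * poly (norm_poly h) B ^ p))"
    using L1 W0 B1 poly_norm_poly_nonneg[of B h]
    by (intro mult_right_mono power_increasing mult_nonneg_nonneg zero_le_power) (auto simp: M)
  also have "\<dots> = W * K ^ p"
    by (simp add: K_def power_mult_distrib mult_ac power_add flip: power_mult)
  finally show False using p(3) L1 by (simp add: mult_left_mono)
qed

section \<open>Norms and algebraic numbers\<close>

lemma fact_in_Rats: "fact n \<in> (\<rat> :: 'a :: field_char_0 set)"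
  by (metis Rats_of_nat of_nat_fact)

lemma coeff_mult_Rats:
  assumes "\<And>i. coeff p i \<in> \<rat>" "\<And>i. coeff q i \<in> \<rat>"
  shows "coeff (p * q) i \<in> \<rat>"
  by (auto simp: coeff_mult intro!: Rats_sum Rats_mult assms)

lemma coeff_monom_Rats: "c \<in> \<rat> \<Longrightarrow> coeff (monom c n) i \<in> \<rat>"
  by auto

lemma coeff_pCons_Rats:
  assumes "c \<in> \<rat>" "\<And>i. coeff p i \<in> \<rat>"
  shows "coeff (pCons c p) i \<in> \<rat>"
  using assms by (cases i) auto

lemma coeff_pcompose_Rats:
  assumes "\<And>i. coeff p i \<in> \<rat>" "\<And>i. coeff q i \<in> \<rat>"
  shows "coeff (pcompose p q) i \<in> \<rat>"
  using assms by (intro coeff_pcompose_semiring_closed) auto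

text \<open>Long division subtracts only rational multiples of shifts of \<open>g\<close>.
  Rationality is recorded for the remainder only, because \<open>q * g\<close> disappears at the
  roots of \<open>g\<close>.\<close>

lemma Rats_poly_division:
  fixes p g :: "complex poly"
  assumes "g \<noteq> 0" "\<And>i. coeff g i \<in> \<rat>" "\<And>i. coeff p i \<in> \<rat>"
  shows "\<exists>q r. p = q * g + r \<and> (r = 0 \<or> degree r < degree g) \<and> (\<forall>i. coeff r i \<in> \<rat>)"
  using assms(3)
proof (induction "degree p" arbitrary: p rule: less_induct)
  case less
  show ?case
  proof (cases "p = 0 \<or> degree p < degree g")
    case True
    then show ?thesis using less.prems by (intro exI[of _ 0] exI[of _ p]) auto
  next
    case False
    define m where "m = monom (lead_coeff p / lead_coeff g) (degree p - degree g)"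
    define p' where "p' = p - m * g"
    have m_Rats: "coeff m i \<in> \<rat>" for i
      unfolding m_def using assms(2) less.prems by (intro coeff_monom_Rats Rats_divide) auto
    have p'_Rats: "coeff p' i \<in> \<rat>" for i
      unfolding p'_def using coeff_mult_Rats[OF m_Rats assms(2)] less.prems by auto
    show ?thesis
    proof (cases "p' = 0")
      case True
      then show ?thesis by (intro exI[of _ m] exI[of _ 0]) (auto simp: p'_def)
    next
      case p': False
      have "degree (m * g) \<le> degree p"
        using False degree_mult_le[of m g] degree_monom_le[of "lead_coeff p / lead_coeff g" "degree p - degree g"]
        by (auto simp: m_def)
      then have "degree p' \<le> degree p"
        unfolding p'_def by (intro degree_diff_le) auto
      moreover have "coeff p' (degree p) = 0"
        using False assms(1) by (simp add: p'_def m_def coeff_monom_mult)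
      ultimately have "degree p' < degree p"
        using p' by (metis le_neq_implies_less leading_coeff_0_iff)
      then obtain q r where "p' = q * g + r" "r = 0 \<or> degree r < degree g" "\<forall>i. coeff r i \<in> \<rat>"
        using less.hyps[of p'] p'_Rats by blast
      then show ?thesis
        by (intro exI[of _ "q + m"] exI[of _ r]) (auto simp: p'_def algebra_simps)
    qed
  qed
qed

text \<open>
  The product is, up to a power of the leading coefficient, the resultant of \<open>g\<close> and \<open>p\<close>;
  the induction is the Euclidean algorithm together with the symmetry of the resultant.
\<close>
lemma prod_roots_Rats:
  fixes g p :: "complex poly"
  assumes "g \<noteq> 0" "\<And>i. coeff g i \<in> \<rat>" "\<And>i. coeff p i \<in> \<rat>"
    and "g = smult (lead_coeff g) (\<Prod>x\<in>#A. [:-x, 1:])"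
  shows "(\<Prod>a\<in>#A. poly p a) \<in> \<rat>"
  using assms
proof (induction "degree g" arbitrary: g p A rule: less_induct)
  case less
  obtain q r where qr: "p = q * g + r" "r = 0 \<or> degree r < degree g" "\<forall>i. coeff r i \<in> \<rat>"
    using Rats_poly_division[of g p] less.prems by blast
  have poly_g: "poly g x = lead_coeff g * (\<Prod>a\<in>#A. x - a)" for x
    by (subst less.prems(4)) (simp add: poly_prod_mset)
  have poly_p: "poly p a = poly r a" if "a \<in># A" for a
  proof -
    have "(\<Prod>b\<in>#A. a - b) = 0"
      using that by (auto simp: prod_mset_zero_iff)
    then show ?thesis by (simp add: qr(1) poly_g)
  qed
  show ?case
  proof (cases "r = 0")
    case True
    then have "(\<Prod>a\<in>#A. poly p a) = (\<Prod>a\<in>#A. 0)"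
      using poly_p by (intro arg_cong[where f = prod_mset] image_mset_cong) auto
    then show ?thesis by (cases "A = {#}") auto
  next
    case False
    obtain B where B: "r = smult (lead_coeff r) (\<Prod>x\<in>#B. [:-x, 1:])"
      using alg_closed_imp_factorization[OF False] by blast
    have poly_r: "poly r x = lead_coeff r * (\<Prod>b\<in>#B. x - b)" for x
      by (subst B) (simp add: poly_prod_mset)
    \<comment> \<open>Up to sign and leading coefficient the product is \<open>g\<close> evaluated
      at \<open>b\<close>; this trades a product over the roots of \<open>g\<close> for one over the
      roots of \<open>r\<close>.\<close>
    have flip: "(\<Prod>a\<in>#A. a - b) = (-1) ^ size A / lead_coeff g * poly g b" for b
    proof -
      have "(\<Prod>a\<in>#A. a - b) = (\<Prod>a\<in>#A. (-1) * (b - a))"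
        by (intro arg_cong[where f = prod_mset] image_mset_cong) auto
      also have "\<dots> = (-1) ^ size A * (\<Prod>a\<in>#A. b - a)"
        by (simp only: prod_mset.distrib prod_mset_constant)
      finally show ?thesis using less.prems(1) by (simp add: poly_g)
    qed
    have "(\<Prod>a\<in>#A. poly p a) = (\<Prod>a\<in>#A. lead_coeff r * (\<Prod>b\<in>#B. a - b))"
      using poly_p poly_r by (intro arg_cong[where f = prod_mset] image_mset_cong) auto
    also have "\<dots> = lead_coeff r ^ size A * (\<Prod>a\<in>#A. \<Prod>b\<in>#B. a - b)"
      by (simp only: prod_mset.distrib prod_mset_constant)
    also have "(\<Prod>a\<in>#A. \<Prod>b\<in>#B. a - b) = (\<Prod>b\<in>#B. \<Prod>a\<in>#A. a - b)"
      by (rule prod_mset.swap)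
    also have "\<dots> = ((-1) ^ size A / lead_coeff g) ^ size B * (\<Prod>b\<in>#B. poly g b)"
      by (simp only: flip prod_mset.distrib prod_mset_constant)
    finally have "(\<Prod>a\<in>#A. poly p a) = lead_coeff r ^ size A *
      (((-1) ^ size A / lead_coeff g) ^ size B * (\<Prod>b\<in>#B. poly g b))" .
    \<comment> \<open>The induction hypothesis applies with \<open>r\<close> and \<open>g\<close> in
      exchanged roles, as \<open>r\<close> has smaller degree.\<close>
    moreover have "(\<Prod>b\<in>#B. poly g b) \<in> \<rat>"
      using less.hyps[of r g B] False B qr less.prems by blast
    ultimately show ?thesis
      using qr(3) less.prems(2) by (auto intro!: Rats_mult Rats_power Rats_divide)
  qed
qed

text \<open>Dividing by X - k lowers the degree, and the quotient is again rational at all naturals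
  beyond \<open>k\<close>. The threshold \<open>k\<close> varies so that the induction never divides
  by zero.\<close>

lemma coeff_Rats_of_values:
  fixes p :: "complex poly"
  assumes "\<And>n. n \<ge> k \<Longrightarrow> poly p (of_nat n) \<in> \<rat>"
  shows "coeff p i \<in> \<rat>"
  using assms
proof (induction "degree p" arbitrary: p k i)
  case 0
  then obtain c where "p = [:c:]" using degree_eq_zeroE by metis
  with 0(2)[of k] show ?case by (auto intro: coeff_pCons_Rats)
next
  case (Suc d)
  define q where "q = synthetic_div p (of_nat k)"
  have p: "p = [:- of_nat k, 1:] * q + [:poly p (of_nat k):]"
    unfolding q_def by (rule synthetic_div_correct'[symmetric])
  have "poly q (of_nat n) \<in> \<rat>" if "n \<ge> Suc k" for n
  proof -
    have "poly p (of_nat n) = (of_nat n - of_nat k) * poly q (of_nat n) + poly p (of_nat k)"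
      by (subst p) (simp add: algebra_simps)
    then have "poly q (of_nat n) = (poly p (of_nat n) - poly p (of_nat k)) / (of_nat n - of_nat k)"
      using that by (simp add: field_simps)
    also have "\<dots> \<in> \<rat>"
      using that Suc.prems by (intro Rats_divide Rats_diff) auto
    finally show ?thesis .
  qed
  then have "coeff q i \<in> \<rat>" for i
    using Suc.hyps(1)[of q "Suc k"] Suc.hyps(2) by (simp add: q_def degree_synthetic_div)
  then have "coeff ([:- of_nat k, 1:] * q) i \<in> \<rat>"
    by (intro coeff_mult_Rats coeff_pCons_Rats) auto
  moreover have "coeff [:poly p (of_nat k):] i \<in> \<rat>"
    using Suc.prems by (intro coeff_pCons_Rats) auto
  ultimately show ?case by (subst p) (auto simp del: mult_pCons_left)
qed

text \<open>The norm of a polynomial whose coefficients depend polynomially on a root. Specializing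
  the variable to a natural number \<open>n\<close> leaves a rational polynomial \<open>R n\<close>
  in the root, which reduces the claim to products of values and avoids bivariate
  polynomials.\<close>

lemma coeff_prod_roots_Rats:
  fixes g :: "complex poly" and \<Phi> :: "complex \<Rightarrow> complex poly" and R :: "nat \<Rightarrow> complex poly"
  assumes g: "g \<noteq> 0" "\<And>i. coeff g i \<in> \<rat>" "g = smult (lead_coeff g) (\<Prod>x\<in>#A. [:-x, 1:])"
    and R: "\<And>n i. coeff (R n) i \<in> \<rat>" "\<And>n x. poly (\<Phi> x) (of_nat n) = poly (R n) x"
  shows "coeff (\<Prod>a\<in>#A. \<Phi> a) i \<in> \<rat>"
proof (rule coeff_Rats_of_values)
  fix n
  have "(\<Prod>a\<in>#A. poly (R n) a) \<in> \<rat>"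
    by (rule prod_roots_Rats[OF g(1,2) R(1) g(3)])
  then show "poly (\<Prod>a\<in>#A. \<Phi> a) (of_nat n) \<in> \<rat>"
    by (simp add: poly_prod_mset R(2))
qed

lemma mem_roots_of_factorization:
  fixes g :: "complex poly"
  assumes "g \<noteq> 0" "g = smult (lead_coeff g) (\<Prod>x\<in>#A. [:-x, 1:])"
  shows "a \<in># A \<longleftrightarrow> poly g a = 0"
proof -
  have "poly g a = lead_coeff g * (\<Prod>b\<in>#A. a - b)"
    by (subst assms(2)) (simp add: poly_prod_mset)
  then show ?thesis using assms(1) by (auto simp: prod_mset_zero_iff)
qed

text \<open>\<open>y\<close> is a root of the norm \<open>\<Prod> \<Phi> a\<close>, the product being over the conjugates of \<open>x\<close>.\<close>
lemma algebraic_if_root_over_algebraic: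
  fixes x y :: complex and \<Phi> :: "complex \<Rightarrow> complex poly"
  assumes "algebraic x" "poly (\<Phi> x) y = 0" "\<And>a. \<Phi> a \<noteq> 0"
    and R: "\<And>n i. coeff (R n) i \<in> \<rat>" "\<And>n x. poly (\<Phi> x) (of_nat n) = poly (R n) x"
  shows "algebraic y"
proof -
  obtain g where g: "\<And>i. coeff g i \<in> \<rat>" "g \<noteq> 0" "poly g x = 0"
    using assms(1) unfolding algebraic_altdef by blast
  obtain A where A: "g = smult (lead_coeff g) (\<Prod>x\<in>#A. [:-x, 1:])"
    using alg_closed_imp_factorization[OF g(2)] by blast
  show ?thesis
  proof (rule algebraicI')
    show "coeff (\<Prod>a\<in>#A. \<Phi> a) i \<in> \<rat>" for i
      by (rule coeff_prod_roots_Rats[OF g(2,1) A R])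
    show "(\<Prod>a\<in>#A. \<Phi> a) \<noteq> 0"
      using assms(3) by (auto simp: prod_mset_zero_iff)
    have "x \<in># A" using mem_roots_of_factorization[OF g(2) A] g(3) by simp
    then show "poly (\<Prod>a\<in>#A. \<Phi> a) y = 0"
      using assms(2) by (auto simp: poly_prod_mset prod_mset_zero_iff intro: image_eqI[of _ _ x])
  qed
qed

section \<open>Sums of algebraic numbers and roots of quadratics\<close>

lemma algebraic_add:
  fixes x y :: complex
  assumes "algebraic x" "algebraic y"
  shows "algebraic (x + y)"
proof -
  obtain f where f: "\<And>i. coeff f i \<in> \<rat>" "f \<noteq> 0" "poly f y = 0"
    using assms(2) unfolding algebraic_altdef by blast
  show ?thesis
  \<comment> \<open>Here \<Phi> a is f(X - a), which has the root x + y for a = x; at X = n it is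
    the rational polynomial f(n - X) evaluated at a.\<close>
  proof (rule algebraic_if_root_over_algebraic[OF assms(1)])
    show "poly (pcompose f [:-x, 1:]) (x + y) = 0"
      using f by (simp add: poly_pcompose)
    show "pcompose f [:-a, 1:] \<noteq> 0" for a
      using f by (simp add: pcompose_eq_0_iff)
    show "coeff (pcompose f [:of_nat n, -1:]) i \<in> \<rat>" for n i
      using f by (intro coeff_pcompose_Rats coeff_pCons_Rats) auto
    show "poly (pcompose f [:-a, 1:]) (of_nat n) = poly (pcompose f [:of_nat n, -1:]) a" for a n
      by (simp add: poly_pcompose)
  qed
qed

lemma algebraic_diff:
  fixes x y :: complex
  shows "algebraic x \<Longrightarrow> algebraic y \<Longrightarrow> algebraic (x - y)"
  using algebraic_add[of x "- y"] by simp

text \<open>Since y^2 - (x + y) y = - x y, a polynomial \<open>f\<close> annihilating - x y makes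
  \<open>y\<close> a root of f(X^2 - a X) with a = x + y algebraic.\<close>

lemma algebraic_if_sum_product_algebraic:
  fixes x y :: complex
  assumes "algebraic (x + y)" "algebraic (x * y)"
  shows "algebraic y"
proof -
  have "algebraic (- (x * y))" using assms(2) by simp
  then obtain f where f: "\<And>i. coeff f i \<in> \<rat>" "f \<noteq> 0" "poly f (- (x * y)) = 0"
    unfolding algebraic_altdef by blast
  show ?thesis
  proof (rule algebraic_if_root_over_algebraic[OF assms(1)])
    show "poly (pcompose f [:0, - (x + y), 1:]) y = 0"
      using f(3) by (simp add: poly_pcompose algebra_simps)
    show "pcompose f [:0, - a, 1:] \<noteq> 0" for a
      using f by (simp add: pcompose_eq_0_iff)
    show "coeff (pcompose f [:of_nat (n * n), - of_nat n:]) i \<in> \<rat>" for n i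
      using f by (intro coeff_pcompose_Rats coeff_pCons_Rats) auto
    show "poly (pcompose f [:0, - a, 1:]) (of_nat n) = poly (pcompose f [:of_nat (n * n), - of_nat n:]) a" for a n
      by (simp add: poly_pcompose algebra_simps)
  qed
qed

section \<open>Exponential polynomials\<close>

text \<open>\<open>v\<close> is the value at 1 of the exponential polynomial with Taylor series \<open>f\<close>.\<close>
definition exp_poly :: "complex fps \<Rightarrow> complex \<Rightarrow> bool" where
  "exp_poly f v \<longleftrightarrow> (\<exists>A c. finite A \<and> (\<forall>\<gamma>\<in>A. algebraic \<gamma>) \<and>
     f = (\<Sum>\<gamma>\<in>A. of_int (c \<gamma>) * fps_exp \<gamma>) \<and> v = (\<Sum>\<gamma>\<in>A. of_int (c \<gamma>) * exp \<gamma>))"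

text \<open>Indexed families may repeat exponents, as sums and products of exponential polynomials
  do; equal exponents are merged by adding their weights.\<close>

lemma exp_poly_sum:
  assumes "finite I" "\<And>i. i \<in> I \<Longrightarrow> algebraic (b i)"
  shows "exp_poly (\<Sum>i\<in>I. of_int (c i) * fps_exp (b i)) (\<Sum>i\<in>I. of_int (c i) * exp (b i))"
proof -
  define d where "d \<gamma> = (\<Sum>i | i \<in> I \<and> b i = \<gamma>. c i)" for \<gamma>
  have "(\<Sum>i\<in>I. of_int (c i) * fps_exp (b i)) = (\<Sum>\<gamma>\<in>b ` I. of_int (d \<gamma>) * fps_exp \<gamma>)"
    by (subst sum.image_gen[OF assms(1), of _ b]) (auto simp: d_def sum_distrib_right intro!: sum.cong)
  moreover have "(\<Sum>i\<in>I. of_int (c i) * exp (b i)) = (\<Sum>\<gamma>\<in>b ` I. of_int (d \<gamma>) * exp \<gamma>)"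
    by (subst sum.image_gen[OF assms(1), of _ b]) (auto simp: d_def sum_distrib_right intro!: sum.cong)
  ultimately show ?thesis
    unfolding exp_poly_def using assms by (intro exI[of _ "b ` I"] exI[of _ d]) auto
qed

lemma exp_poly_exp: "algebraic a \<Longrightarrow> exp_poly (fps_exp a) (exp a)"
  using exp_poly_sum[of "{()}" "\<lambda>_. a" "\<lambda>_. 1"] by simp

lemma exp_poly_of_int: "exp_poly (of_int k) (of_int k)"
  using exp_poly_sum[of "{()}" "\<lambda>_. 0" "\<lambda>_. k"] by simp

lemma exp_poly_add:
  assumes "exp_poly f u" "exp_poly g v"
  shows "exp_poly (f + g) (u + v)"
proof -
  obtain A c where A: "finite A" "\<forall>\<gamma>\<in>A. algebraic \<gamma>"
     "f = (\<Sum>\<gamma>\<in>A. of_int (c \<gamma>) * fps_exp \<gamma>)" "u = (\<Sum>\<gamma>\<in>A. of_int (c \<gamma>) * exp \<gamma>)"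
    using assms(1) unfolding exp_poly_def by blast
  obtain B d where B: "finite B" "\<forall>\<gamma>\<in>B. algebraic \<gamma>"
     "g = (\<Sum>\<gamma>\<in>B. of_int (d \<gamma>) * fps_exp \<gamma>)" "v = (\<Sum>\<gamma>\<in>B. of_int (d \<gamma>) * exp \<gamma>)"
    using assms(2) unfolding exp_poly_def by blast
  have "algebraic (case_sum id id i)" if "i \<in> A <+> B" for i
    using that A(2) B(2) by auto
  then show ?thesis
    using exp_poly_sum[of "A <+> B" "case_sum id id" "case_sum c d"] A B
    by (simp add: sum.Plus)
qed

lemma exp_poly_mult:
  assumes "exp_poly f u" "exp_poly g v"
  shows "exp_poly (f * g) (u * v)"
proof -
  obtain A c where A: "finite A" "\<forall>\<gamma>\<in>A. algebraic \<gamma>"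
     "f = (\<Sum>\<gamma>\<in>A. of_int (c \<gamma>) * fps_exp \<gamma>)" "u = (\<Sum>\<gamma>\<in>A. of_int (c \<gamma>) * exp \<gamma>)"
    using assms(1) unfolding exp_poly_def by blast
  obtain B d where B: "finite B" "\<forall>\<gamma>\<in>B. algebraic \<gamma>"
     "g = (\<Sum>\<gamma>\<in>B. of_int (d \<gamma>) * fps_exp \<gamma>)" "v = (\<Sum>\<gamma>\<in>B. of_int (d \<gamma>) * exp \<gamma>)"
    using assms(2) unfolding exp_poly_def by blast
  have "f * g = (\<Sum>i\<in>A \<times> B. of_int (c (fst i) * d (snd i)) * fps_exp (fst i + snd i))"
    by (simp add: A B sum_product sum.cartesian_product case_prod_unfold fps_exp_add_mult mult_ac)
  moreover have "u * v = (\<Sum>i\<in>A \<times> B. of_int (c (fst i) * d (snd i)) * exp (fst i + snd i))"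
    by (simp add: A B sum_product sum.cartesian_product case_prod_unfold exp_add mult_ac)
  moreover have "algebraic (fst i + snd i)" if "i \<in> A \<times> B" for i
    using that A(2) B(2) by (auto intro: algebraic_add)
  ultimately show ?thesis
    using exp_poly_sum[of "A \<times> B" "\<lambda>i. fst i + snd i" "\<lambda>i. c (fst i) * d (snd i)"] A(1) B(1)
    by simp
qed

lemma exp_poly_power: "exp_poly f u \<Longrightarrow> exp_poly (f ^ n) (u ^ n)"
  using exp_poly_of_int[of 1] by (induction n) (auto intro: exp_poly_mult)

lemma exp_poly_sum_closed:
  assumes "\<And>i. i \<in> I \<Longrightarrow> exp_poly (f i) (u i)"
  shows "exp_poly (\<Sum>i\<in>I. f i) (\<Sum>i\<in>I. u i)"
  using assms exp_poly_of_int[of 0]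
  by (induction I rule: infinite_finite_induct) (auto intro: exp_poly_add)

lemma exp_poly_prod_mset_closed:
  assumes "\<And>a. a \<in># A \<Longrightarrow> exp_poly (f a) (u a)"
  shows "exp_poly (\<Prod>a\<in>#A. f a) (\<Prod>a\<in>#A. u a)"
  using assms exp_poly_of_int[of 1]
  by (induction A) (auto intro: exp_poly_mult)

section \<open>Denominators of power sums and nonvanishing at 1\<close>

lemma common_denominator:
  fixes s :: "nat \<Rightarrow> complex"
  assumes "\<And>n. s n \<in> \<rat>"
  shows "\<exists>E::int. E \<noteq> 0 \<and> (\<forall>n<N. of_int E * s n \<in> \<int>)"
proof (induction N)
  case 0
  show ?case by (intro exI[of _ 1]) auto
next
  case (Suc N)
  then obtain E :: int where E: "E \<noteq> 0" "\<And>n. n < N \<Longrightarrow> of_int E * s n \<in> \<int>" by blast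
  obtain a b :: int where ab: "b \<noteq> 0" "s N = of_int a / of_int b"
    using assms[of N] by (metis Rats_cases' less_irrefl)
  have "of_int (E * b) * s n \<in> \<int>" if "n < Suc N" for n
  proof (cases "n = N")
    case True
    then have "of_int (E * b) * s n = of_int (E * a)" using ab by simp
    then show ?thesis by (metis Ints_of_int)
  next
    case False
    then have "of_int b * (of_int E * s n) \<in> \<int>"
      using that by (intro Ints_mult[OF Ints_of_int E(2)]) auto
    then show ?thesis by (simp only: of_int_mult mult_ac)
  qed
  then show ?case using E(1) ab(1) by (intro exI[of _ "E * b"]) auto
qed

text \<open>Each step of the recurrence divides by \<open>l\<close> once, so the denominators grow
  at most like l^n, beyond a constant \<open>E\<close> clearing the initial terms.\<close>

lemma recurrence_denominators:
  fixes s :: "nat \<Rightarrow> complex" and h :: "complex poly" and l :: int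
  assumes rat: "\<And>n. s n \<in> \<rat>" and h: "\<And>i. coeff h i \<in> \<int>" "lead_coeff h = of_int l" "l \<noteq> 0"
    and rec: "\<And>n. (\<Sum>j\<le>degree h. coeff h j * s (n + j)) = 0"
  shows "\<exists>E::int. E \<noteq> 0 \<and> (\<forall>n. of_int l ^ n * (of_int E * s n) \<in> \<int>)"
proof -
  define d where "d = degree h"
  obtain E :: int where E: "E \<noteq> 0" "\<And>n. n < d \<Longrightarrow> of_int E * s n \<in> \<int>"
    using common_denominator[of s d] rat by blast
  have "of_int l ^ n * (of_int E * s n) \<in> \<int>" for n
  proof (induction n rule: less_induct)
    case (less n)
    show ?case
    proof (cases "n < d")
      case True
      then show ?thesis using E(2) by (intro Ints_mult[OF Ints_power]) auto
    next
      case nd: False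
      show ?thesis
      proof (cases n)
        case 0
        \<comment> \<open>For a constant \<open>h\<close> there are no initial terms, and the
          recurrence itself forces \<open>s 0 = 0\<close>.\<close>
        then have "d = 0" using nd by simp
        then have "of_int l * s 0 = 0"
          using rec[of 0] h(2) by (simp add: d_def)
        then show ?thesis using 0 h(3) by simp
      next
        case (Suc m)
        have "(\<Sum>j\<le>d. coeff h j * s (n - d + j)) = (\<Sum>j<d. coeff h j * s (n - d + j)) + of_int l * s n"
          using nd h(2) by (simp add: d_def flip: lessThan_Suc_atMost)
        then have eq: "of_int l * s n = - (\<Sum>j<d. coeff h j * s (n - d + j))"
          using rec[of "n - d"] by (simp add: d_def add_eq_0_iff)
        have "of_int l ^ n * (of_int E * s n) = of_int l ^ m * of_int E * (of_int l * s n)"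
          by (simp add: Suc mult_ac)
        also have "\<dots> = - (\<Sum>j<d. of_int l ^ m * of_int E * (coeff h j * s (n - d + j)))"
          by (simp add: eq sum_distrib_left)
        also have "\<dots> = - (\<Sum>j<d. coeff h j * of_int l ^ (d - 1 - j) *
            (of_int l ^ (n - d + j) * (of_int E * s (n - d + j))))"
        proof (intro arg_cong[where f = uminus] sum.cong refl)
          fix j assume "j \<in> {..<d}"
          then have "m = (d - 1 - j) + (n - d + j)" using nd Suc by auto
          then have "(of_int l ^ m :: complex) = of_int l ^ (d - 1 - j) * of_int l ^ (n - d + j)"
            by (metis power_add)
          then show "of_int l ^ m * of_int E * (coeff h j * s (n - d + j)) =
            coeff h j * of_int l ^ (d - 1 - j) * (of_int l ^ (n - d + j) * (of_int E * s (n - d + j)))"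
            by (simp only: mult_ac)
        qed
        also have "\<dots> \<in> \<int>"
          using nd by (intro Ints_minus Ints_sum Ints_mult[OF Ints_mult] less.IH h(1) Ints_power) auto
        finally show ?thesis .
      qed
    qed
  qed
  then show ?thesis using E(1) by blast
qed

text \<open>A product of annihilating polynomials, each with nonzero constant term because its root
  is nonzero. The constant term enters the main term of Hermite's sum.\<close>

lemma algebraic_common_int_poly:
  fixes S :: "complex set"
  assumes "finite S" "\<And>x. x \<in> S \<Longrightarrow> algebraic x" "0 \<notin> S"
  shows "\<exists>h. (\<forall>i. coeff h i \<in> \<int>) \<and> coeff h 0 \<noteq> 0 \<and> (\<forall>x\<in>S. poly h x = 0)"
  using assms
proof (induction S)
  case empty
  show ?case by (intro exI[of _ 1]) (auto simp: coeff_pCons split: nat.splits)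
next
  case (insert x S)
  then obtain h where h: "\<forall>i. coeff h i \<in> \<int>" "coeff h 0 \<noteq> 0" "\<forall>x\<in>S. poly h x = 0" by auto
  obtain p where p: "coeff p 0 \<noteq> 0" "poly (map_poly of_int p) x = 0"
    using algebraicE'_nonzero[of x] insert.prems by auto
  have "\<forall>i. coeff (map_poly of_int p * h) i \<in> \<int>"
    using h by (intro allI coeff_mult_Ints) (auto simp: coeff_map_poly)
  with h p show ?case
    by (intro exI[of _ "map_poly of_int p * h"]) (auto simp: coeff_mult coeff_map_poly)
qed

text \<open>In f(z) f(-z) the exponents are differences of elements of \<open>A\<close>, and 0
  occurs exactly on the diagonal, with total weight the sum of squares of the weights. Rationality
  of the Taylor coefficients makes the power sums rational, a recurrence bounds their denominators,
  and Hermite's method applies.\<close>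

lemma exp_poly_value_ne_0:
  assumes "exp_poly f v" "f \<noteq> 0" "\<And>n. fps_nth f n \<in> \<rat>"
  shows "v \<noteq> 0"
proof
  assume "v = 0"
  obtain A c where A: "finite A" "\<forall>\<gamma>\<in>A. algebraic \<gamma>"
     "f = (\<Sum>\<gamma>\<in>A. of_int (c \<gamma>) * fps_exp \<gamma>)" "v = (\<Sum>\<gamma>\<in>A. of_int (c \<gamma>) * exp \<gamma>)"
    using assms(1) unfolding exp_poly_def by blast
  define I where "I = A \<times> A"
  define w where "w i = c (fst i) * c (snd i)" for i
  define b :: "complex \<times> complex \<Rightarrow> complex" where "b i = fst i - snd i" for i
  define s where "s n = (\<Sum>i\<in>I. of_int (w i) * b i ^ n)" for n
  have fin: "finite I" using A by (simp add: I_def)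
  have s_rat: "s n \<in> \<rat>" for n
  proof -
    \<comment> \<open>This is the reflection f(-z); its Taylor coefficients differ from those of
      \<open>f\<close> by signs.\<close>
    define f' where "f' = (\<Sum>\<gamma>\<in>A. of_int (c \<gamma>) * fps_exp (- \<gamma>))"
    have nth_int: "fps_nth (of_int k * F) n = of_int k * fps_nth F n" for k n and F :: "complex fps"
      by (simp flip: fps_of_int)
    have "fps_nth f' n = (-1) ^ n * fps_nth f n" for n
      unfolding f'_def A
      by (simp add: fps_sum_nth nth_int sum_distrib_left) (subst power_minus, simp add: mult_ac)
    then have f'_rat: "fps_nth f' n \<in> \<rat>" for n
      using assms(3) by (auto intro!: Rats_mult Rats_power)
    have "fps_exp (x - y) = fps_exp x * fps_exp (- y)" for x y :: complex
      using fps_exp_add_mult[of x "- y"] by simp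
    then have "f * f' = (\<Sum>i\<in>I. of_int (w i) * fps_exp (b i))"
      by (simp add: A f'_def I_def w_def b_def sum_product sum.cartesian_product case_prod_unfold mult_ac)
    then have "s n = fact n * fps_nth (f * f') n"
      by (simp add: s_def fps_sum_nth nth_int sum_distrib_left)
    also have "\<dots> \<in> \<rat>"
      unfolding fps_mult_nth using assms(3) f'_rat
      by (intro Rats_mult Rats_sum fact_in_Rats) auto
    finally show ?thesis .
  qed
  have "algebraic x" if "x \<in> b ` I - {0}" for x
    using that A(2) by (auto simp: I_def b_def intro!: algebraic_diff)
  then obtain h where h: "\<forall>i. coeff h i \<in> \<int>" "coeff h 0 \<noteq> 0" "\<forall>x\<in>b ` I - {0}. poly h x = 0"
    using algebraic_common_int_poly[of "b ` I - {0}"] fin by auto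
  then have h_roots: "poly h (b i) = 0" if "i \<in> I" "b i \<noteq> 0" for i
    using that by blast
  obtain l where l: "lead_coeff h = of_int l" using h(1) by (metis Ints_cases)
  have "h \<noteq> 0" using h(2) by auto
  then have "l \<noteq> 0" using l by auto
  have "\<exists>E::int. E \<noteq> 0 \<and> (\<forall>n. of_int l ^ n * (of_int E * s n) \<in> \<int>)"
  \<comment> \<open>The extra factor X also kills the exponent 0, so the recurrence holds from n = 0
    on; the leading coefficient is unchanged.\<close>
  proof (rule recurrence_denominators[where h = "pCons 0 h"])
    show "coeff (pCons 0 h) i \<in> \<int>" for i using h(1) by (cases i) auto
    show "lead_coeff (pCons 0 h) = of_int l" using l \<open>h \<noteq> 0\<close> by simp
    show "l \<noteq> 0" by fact
    have "poly (pCons 0 h) (b i) = 0" if "i \<in> I" for i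
      using h_roots[OF that] by auto
    then have "0 = (\<Sum>i\<in>I. of_int (w i) * b i ^ n * poly (pCons 0 h) (b i))" for n
      by (intro sum.neutral[symmetric]) auto
    also have "\<And>n. \<dots> n = (\<Sum>j\<le>degree (pCons 0 h). coeff (pCons 0 h) j * s (n + j))"
      unfolding poly_altdef s_def sum_distrib_left
      by (subst sum.swap) (simp only: power_add mult_ac)
    finally show "(\<Sum>j\<le>degree (pCons 0 h). coeff (pCons 0 h) j * s (n + j)) = 0" for n
      by simp
  qed (rule s_rat)
  then obtain E :: int where E: "E \<noteq> 0" "\<And>n. of_int l ^ n * (of_int E * s n) \<in> \<int>" by blast
  have "(\<Sum>i\<in>I. of_int (E * w i) * exp (b i)) \<noteq> 0"
  proof (rule exp_sum_ne_0[OF fin])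
    have "\<exists>\<gamma>\<in>A. c \<gamma> \<noteq> 0"
    proof (rule ccontr)
      assume "\<not> (\<exists>\<gamma>\<in>A. c \<gamma> \<noteq> 0)"
      then have "f = 0" unfolding A by (intro sum.neutral) auto
      with assms(2) show False by simp
    qed
    then have "(\<Sum>\<gamma>\<in>A. c \<gamma> * c \<gamma>) > 0"
      using A(1) by (auto intro!: sum_pos2 simp: zero_less_mult_iff)
    moreover have "(\<Sum>i | i \<in> I \<and> b i = 0. w i) = (\<Sum>\<gamma>\<in>A. c \<gamma> * c \<gamma>)"
      by (rule sum.reindex_bij_witness[where i = "\<lambda>x. (x, x)" and j = fst]) (auto simp: I_def b_def w_def)
    ultimately show "(\<Sum>i | i \<in> I \<and> b i = 0. E * w i) \<noteq> 0"
      using E(1) by (simp flip: sum_distrib_left)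
    show "of_int l ^ n * (\<Sum>i\<in>I. of_int (E * w i) * b i ^ n) \<in> \<int>" for n
      using E(2)[of n] by (simp add: s_def sum_distrib_left mult_ac)
  qed (use h h_roots \<open>l \<noteq> 0\<close> in auto)
  moreover have "v * (\<Sum>\<gamma>\<in>A. of_int (c \<gamma>) * exp (- \<gamma>)) = (\<Sum>i\<in>I. of_int (w i) * exp (b i))"
    by (simp add: A(4) I_def w_def b_def sum_product sum.cartesian_product case_prod_unfold
          exp_diff exp_minus divide_inverse mult_ac)
  then have "(\<Sum>i\<in>I. of_int (E * w i) * exp (b i)) = of_int E * (v * (\<Sum>\<gamma>\<in>A. of_int (c \<gamma>) * exp (- \<gamma>)))"
    by (simp add: sum_distrib_left mult.assoc)
  ultimately show False using \<open>v = 0\<close> by simp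
qed

section \<open>Polynomials in exponential series\<close>

definition fps_poly :: "complex poly \<Rightarrow> complex fps \<Rightarrow> complex fps"
  where "fps_poly p f = poly (map_poly fps_const p) f"

lemma fps_poly_altdef: "fps_poly p f = (\<Sum>k\<le>degree p. fps_const (coeff p k) * f ^ k)"
  by (simp add: fps_poly_def poly_altdef coeff_map_poly degree_map_poly)

text \<open>Over the complex numbers \<open>p\<close> splits into linear factors, and power series
  form an integral domain, so some factor f - r vanishes.\<close>

lemma fps_poly_eq_0_imp_const:
  assumes "fps_poly p f = 0" "p \<noteq> 0"
  shows "\<exists>c. f = fps_const c"
  using assms
proof (induction "degree p" arbitrary: p)
  case 0
  then obtain c where "p = [:c:]" using degree_eq_zeroE by metis
  with 0 show ?case by (simp add: fps_poly_def map_poly_pCons)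
next
  case (Suc d)
  obtain r where "poly p r = 0"
    using alg_closed_imp_poly_has_root[of p] Suc.hyps(2) by auto
  then obtain q where q: "p = [:- r, 1:] * q"
    by (auto simp: poly_eq_0_iff_dvd elim: dvdE)
  have q0: "q \<noteq> 0" using Suc.prems q by auto
  have smult: "fps_poly (smult c q) f = fps_const c * fps_poly q f" for c
    unfolding fps_poly_def by (simp add: map_poly_smult)
  have add: "map_poly fps_const (x + y) = map_poly fps_const x + map_poly fps_const y" for x y :: "complex poly"
    by (rule poly_eqI) (simp add: coeff_map_poly)
  have "fps_poly p f = (f - fps_const r) * fps_poly q f"
    using smult[of "-r"] add[of "smult (-r) q" "pCons 0 q"] unfolding q fps_poly_def
    by (simp add: map_poly_pCons algebra_simps flip: fps_const_neg)
  then consider "f = fps_const r" | "fps_poly q f = 0"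
    using Suc.prems by auto
  then show ?case
  proof cases
    case 2
    have "degree q = d" using Suc.hyps(2) q q0 by (simp add: degree_mult_eq del: mult_pCons_left)
    then show ?thesis using Suc.hyps(1)[of q] 2 q0 by simp
  qed auto
qed

text \<open>The coefficients of orders 1 and 2 would give a + m = 0 and a^2 + m = 0, hence m^2 + m =
  0, which for a natural number means m = 0 and then a = 0.\<close>

lemma fps_exp_sum_not_const:
  fixes a c :: complex and m :: nat
  assumes "a \<noteq> 0 \<or> m \<noteq> 0"
  shows "fps_exp a + of_nat m * fps_exp 1 \<noteq> fps_const c"
proof
  assume eq: "fps_exp a + of_nat m * fps_exp 1 = fps_const c"
  have nth: "fps_nth (fps_exp a + of_nat m * fps_exp 1) n = (a ^ n + of_nat m) / fact n" for n
    by (simp add: add_divide_distrib flip: fps_of_nat)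
  have "a + of_nat m = 0" "a\<^sup>2 + of_nat m = 0"
    using nth[of 1] nth[of 2] unfolding eq by (simp_all add: fact_numeral)
  then have "a = - of_nat m" "of_nat (m * m + m) = (0 :: complex)"
    by (auto simp: add_eq_0_iff power2_eq_square)
  then show False using assms by (auto simp del: of_nat_add of_nat_mult)
qed

text \<open>Congruence modulo X^(N+1), which respects sums and products.\<close>

definition fps_agree :: "nat \<Rightarrow> complex fps \<Rightarrow> complex fps \<Rightarrow> bool"
  where "fps_agree N f g \<longleftrightarrow> (\<forall>i\<le>N. fps_nth f i = fps_nth g i)"

lemma fps_agree_refl: "fps_agree N f f"
  by (simp add: fps_agree_def)

lemma fps_agree_add: "fps_agree N f g \<Longrightarrow> fps_agree N f' g' \<Longrightarrow> fps_agree N (f + f') (g + g')"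
  by (simp add: fps_agree_def)

lemma fps_agree_mult: "fps_agree N f g \<Longrightarrow> fps_agree N f' g' \<Longrightarrow> fps_agree N (f * f') (g * g')"
  by (auto simp: fps_agree_def fps_mult_nth intro!: sum.cong)

lemma fps_agree_fps_poly:
  assumes "fps_agree N f g"
  shows "fps_agree N (fps_poly p f) (fps_poly p g)"
  using assms
  by (induction p) (auto simp: fps_poly_def map_poly_pCons intro!: fps_agree_add fps_agree_mult fps_agree_refl)

lemma fps_of_poly_pcompose: "fps_of_poly (pcompose p q) = fps_poly p (fps_of_poly q)"
  by (induction p) (auto simp: fps_poly_def pcompose_pCons map_poly_pCons fps_of_poly_add fps_of_poly_mult
      fps_of_poly_const)

lemma fps_agree_prod_mset:
  assumes "\<And>a. fps_agree N (f a) (g a)"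
  shows "fps_agree N (\<Prod>a\<in>#A. f a) (\<Prod>a\<in>#A. g a)"
  using assms by (induction A) (auto intro: fps_agree_mult fps_agree_refl)

lemma fps_of_poly_prod_mset: "fps_of_poly (\<Prod>a\<in>#A. f a) = (\<Prod>a\<in>#A. fps_of_poly (f a))"
  by (induction A) (auto simp: fps_of_poly_mult)

text \<open>Truncating the exponential series at order \<open>N\<close> reduces the claim to products of polynomials.\<close>
lemma prod_roots_fps_exp_Rats:
  fixes g p :: "complex poly" and m :: nat
  assumes g: "g \<noteq> 0" "\<And>i. coeff g i \<in> \<rat>" "g = smult (lead_coeff g) (\<Prod>x\<in>#A. [:-x, 1:])"
    and p: "\<And>i. coeff p i \<in> \<rat>"
  shows "fps_nth (\<Prod>a\<in>#A. fps_poly p (fps_exp a + of_nat m * fps_exp 1)) N \<in> \<rat>"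
proof -
  define e where "e a = (\<Sum>k\<le>N. monom (a ^ k / fact k) k)" for a :: complex
  define \<Phi> where "\<Phi> a = pcompose p (e a + smult (of_nat m) (e 1))" for a
  have coeff_e: "coeff (e a) i = (if i \<le> N then a ^ i / fact i else 0)" for a i
    by (simp add: e_def coeff_sum)
  have poly_e: "poly (e a) x = (\<Sum>k\<le>N. a ^ k / fact k * x ^ k)" for a x
    by (simp add: e_def poly_sum poly_monom)
  have "fps_agree N (fps_of_poly (e a + smult (of_nat m) (e 1))) (fps_exp a + of_nat m * fps_exp 1)" for a
    by (auto simp: fps_agree_def coeff_e simp flip: fps_of_nat)
  then have "fps_agree N (fps_of_poly (\<Phi> a)) (fps_poly p (fps_exp a + of_nat m * fps_exp 1))" for a
    unfolding \<Phi>_def fps_of_poly_pcompose by (rule fps_agree_fps_poly)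
  then have "fps_agree N (fps_of_poly (\<Prod>a\<in>#A. \<Phi> a)) (\<Prod>a\<in>#A. fps_poly p (fps_exp a + of_nat m * fps_exp 1))"
    unfolding fps_of_poly_prod_mset by (rule fps_agree_prod_mset)
  then have "fps_nth (\<Prod>a\<in>#A. fps_poly p (fps_exp a + of_nat m * fps_exp 1)) N = coeff (\<Prod>a\<in>#A. \<Phi> a) N"
    by (simp add: fps_agree_def)
  also have "\<dots> \<in> \<rat>"
  proof (rule coeff_prod_roots_Rats[OF g])
    \<comment> \<open>The truncated series of exp(a z) is symmetric in a and z: \<open>e a\<close>
      at \<open>n\<close> equals \<open>e n\<close> at \<open>a\<close>. So at z = n each factor is
      a rational polynomial in the root.\<close>
    show "coeff (pcompose p (e (of_nat n) + [:of_nat m * poly (e 1) (of_nat n):])) i \<in> \<rat>" for n i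
    proof (intro coeff_pcompose_Rats p)
      fix i
      have e_Rats: "coeff (e (of_nat n)) i \<in> \<rat>" for n i
        by (auto simp: coeff_e intro!: Rats_divide Rats_power fact_in_Rats)
      have "of_nat m * poly (e 1) (of_nat n) \<in> \<rat>"
        using e_Rats[of 1] by (auto simp: poly_altdef intro!: Rats_mult Rats_sum Rats_power)
      then have "coeff [:of_nat m * poly (e 1) (of_nat n):] i \<in> \<rat>"
        by (intro coeff_pCons_Rats) auto
      then show "coeff (e (of_nat n) + [:of_nat m * poly (e 1) (of_nat n):]) i \<in> \<rat>"
        using e_Rats by (simp only: coeff_add Rats_add)
    qed
    show "poly (\<Phi> x) (of_nat n) = poly (pcompose p (e (of_nat n) + [:of_nat m * poly (e 1) (of_nat n):])) x" for n x
      by (simp add: \<Phi>_def poly_pcompose poly_e mult_ac)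
  qed
  finally show ?thesis .
qed

section \<open>The transcendence theorem and its consequences\<close>

theorem transcendental_exp_sum:
  fixes a :: complex and m :: nat
  assumes a: "algebraic a" and nz: "a \<noteq> 0 \<or> m \<noteq> 0"
  shows "transcendental (exp a + of_nat m * exp 1)"
proof
  assume "algebraic (exp a + of_nat m * exp 1)"
  then obtain p where p: "\<And>i. coeff p i \<in> \<int>" "p \<noteq> 0" "poly p (exp a + of_nat m * exp 1) = 0"
    by (elim algebraicE) blast
  \<comment> \<open>Excluding the root 0 when m = 0 ensures that every conjugate, and not just
    \<open>a\<close>, yields a nonconstant series and hence a nonzero factor
    \<open>F x\<close>.\<close>
  obtain g where g: "\<And>i. coeff g i \<in> \<int>" "g \<noteq> 0" "poly g a = 0" "m = 0 \<Longrightarrow> poly g 0 \<noteq> 0"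
  proof (cases "a = 0")
    case True
    with nz show ?thesis by (intro that[of "[:0, 1:]"]) (auto simp: coeff_pCons split: nat.splits)
  next
    case False
    with a obtain h where "h \<noteq> 0" "coeff h 0 \<noteq> 0" "poly (map_poly of_int h) a = 0"
      using algebraicE'_nonzero by blast
    moreover from this have "map_poly complex_of_int h \<noteq> 0"
      by (metis coeff_0 coeff_map_poly of_int_0 of_int_eq_0_iff)
    ultimately show ?thesis
      by (intro that[of "map_poly of_int h"]) (auto simp: coeff_map_poly poly_0_coeff_0)
  qed
  obtain A where A: "g = smult (lead_coeff g) (\<Prod>x\<in>#A. [:-x, 1:])"
    using alg_closed_imp_factorization[OF g(2)] by blast
  note mem_A = mem_roots_of_factorization[OF g(2) A]
  define F where "F x = fps_poly p (fps_exp x + of_nat m * fps_exp 1)" for x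
  have "exp_poly (F x) (poly p (exp x + of_nat m * exp 1))" if "algebraic x" for x
    unfolding F_def fps_poly_altdef poly_altdef
  proof (intro exp_poly_sum_closed exp_poly_mult exp_poly_power exp_poly_add exp_poly_exp that)
    show "exp_poly (fps_const (coeff p i)) (coeff p i)" for i
      using p(1)[of i] exp_poly_of_int by (auto elim!: Ints_cases simp: fps_of_int)
    show "exp_poly (of_nat m) (of_nat m)"
      using exp_poly_of_int[of "int m"] by simp
  qed auto
  then have "exp_poly (\<Prod>x\<in>#A. F x) (\<Prod>x\<in>#A. poly p (exp x + of_nat m * exp 1))"
    using g by (intro exp_poly_prod_mset_closed) (auto simp: mem_A intro: algebraicI)
  moreover have "F x \<noteq> 0" if "x \<in># A" for x
  proof -
    have "x \<noteq> 0 \<or> m \<noteq> 0" using that g(4) by (auto simp: mem_A)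
    then show ?thesis
      using fps_exp_sum_not_const fps_poly_eq_0_imp_const p(2) unfolding F_def by blast
  qed
  then have "(\<Prod>x\<in>#A. F x) \<noteq> 0"
    by (auto simp: prod_mset_zero_iff)
  moreover have "fps_nth (\<Prod>x\<in>#A. F x) n \<in> \<rat>" for n
    unfolding F_def using g(1) p(1) Ints_subset_Rats
    by (intro prod_roots_fps_exp_Rats[OF g(2) _ A]) auto
  ultimately have "(\<Prod>x\<in>#A. poly p (exp x + of_nat m * exp 1)) \<noteq> 0"
    by (rule exp_poly_value_ne_0)
  moreover have "a \<in># A" using g(3) by (simp add: mem_A)
  ultimately show False using p(3) by (auto simp: prod_mset_zero_iff)
qed

theorem theorem3:
  fixes t :: complex
  assumes "t \<noteq> 0" and "t \<noteq> 1 / exp 1"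
  shows "(transcendental (t + exp 1) \<and> transcendental (t * exp 1)) \<or>
         (transcendental (t + exp 1) \<and> transcendental (Ln t)) \<or>
         (transcendental (t * exp 1) \<and> transcendental (Ln t))"
proof -
  have "\<not> (algebraic (t + exp 1) \<and> algebraic (t * exp 1))"
    using algebraic_if_sum_product_algebraic[of t "exp 1"] transcendental_exp_sum[of 1 0] by auto
  moreover have "\<not> (algebraic (t + exp 1) \<and> algebraic (Ln t))"
    using transcendental_exp_sum[of "Ln t" 1] assms(1) by auto
  moreover have "\<not> (algebraic (t * exp 1) \<and> algebraic (Ln t))"
  proof
    assume *: "algebraic (t * exp 1) \<and> algebraic (Ln t)"
    have e: "exp (Ln t + 1) = t * exp 1"
      using assms(1) by (simp add: exp_add)
    \<comment> \<open>The exponent vanishes only for t = 1/e, the excluded value.\<close>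
    have "Ln t + 1 \<noteq> 0"
    proof
      assume "Ln t + 1 = 0"
      with e have "t * exp 1 = 1" by simp
      with assms(2) show False by (simp add: field_simps)
    qed
    then have "transcendental (exp (Ln t + 1))"
      using * transcendental_exp_sum[of "Ln t + 1" 0] by (auto intro: algebraic_add)
    with * e show False by simp
  qed
  ultimately show ?thesis by blast
qed

end
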